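(* Assume that $f\in\ell^{\infty}(X)$ and that for all sufficiently large $n$ one has $\hat f_n\in\ell^{\infty}(X)$ almost surely. Suppose that, for a Borel measurable random element $G$ of $\ell^\infty(X)$, $$\sqrt n(\hat f_n-f)\rightsquigarrow G\quad\text{in }\ell^{\infty}(X).$$ Then $$\sqrt n(\hat\psi_n-\psi^{*})\rightsquigarrow\lim_{\varepsilon\downarrow0}\inf_{x\in S^{\varepsilon}}G(x).$$ In particular, $$\hat\psi_n-\psi^{*}=O_{\mathbb P^{*}}(n^{-1/2}),$$ and for every nonnegative deterministic sequence $\delta_n=O(n^{-1/2})$ and every sequence of maps $\hat x_n:\Omega\to X$ satisfying the empirical minimizer membership assumption with respect to $(\delta_n)$, $$f(\hat x_n)-\psi^{*}=O_{\mathbb P^{*}}(n^{-1/2}).$$ If, in addition, $f$ satisfies a sharp-growth inequality of order $\kappa$, then $$\operatorname{dist}(\hat x_n,S^{0})=O_{\mathbb P^{*}}(n^{-1/(2\kappa)}).$$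
   Context: Setting. $(\Omega,\mathcal F,\mathbb P)$ is a probability space, $(\Xi,\mathcal G)$ a measurable space, $\xi,\xi_1,\xi_2,\dots$ are i.i.d. $\Xi$-valued random elements on $\Omega$ with law $P$, $X$ is a nonempty set, and $h:X\times\Xi\to\mathbb R$ is such that each section $h_x=h(x,\cdot)$ is measurable and $P$-integrable. Put $f(x)=\mathbb E[h(x,\xi)]$, $\hat f_n(x)=\frac1n\sum_{i=1}^n h(x,\xi_i)$, $\psi^{*}=\inf_{X}f$, $\hat\psi_n=\inf_{X}\hat f_n$, $S^{\varepsilon}=\{x\in X: f(x)\le\psi^{*}+\varepsilon\}$, $\hat S_n^{\delta}=\{x\in X:\hat f_n(x)\le\hat\psi_n+\delta\}$ ($\varepsilon,\delta\ge0$; $\hat S_n^\delta=\hat S_n^\delta(\omega)$ is random). $\ell^{\infty}(X)$ is the Banach space of bounded real functions on $X$ with the supremum norm. Empirical minimizer membership assumption (for maps $\hat x_n:\Omega\to X$ and nonnegative deterministic $(\delta_n)$): there are events $A_{\min,N}\in\mathcal F$, $N\in\mathbb N$, with $A_{\min,N}\subseteq A_{\min,N+1}$ and $\mathbb P(\bigcup_N A_{\min,N})=1$, such that $\hat x_n(\omega)\in\hat S_n^{\delta_n}(\omega)$ for every $N$, every $\omega\in A_{\min,N}$ and every $n\ge N$. Sharp growth of order $\kappa\ge1$: $X\subseteq\mathbb R^d$, $S^{0}\ne\varnothing$, and there is $\alpha>0$ with $f(x)-\psi^{*}\ge\alpha\operatorname{dist}(x,S^{0})^{\kappa}$ for all $x\in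 X$ (Euclidean distance). Outer probability. For a possibly nonmeasurable $U:\Omega\to[-\infty,\infty]$, $\mathbb E^{*}U=\inf\{\mathbb E[V]: V\ge U,\ V\text{ measurable},\ \mathbb E[V]\text{ exists}\}$, $\mathbb P^{*}(A)=\mathbb E^{*}\mathbf 1_A$. $U_n=O_{\mathbb P^{*}}(r_n)$ means: for every $\varepsilon>0$ there is $M<\infty$ with $\limsup_n\mathbb P^{*}(|U_n|>Mr_n)\le\varepsilon$. Hoffmann–Jørgensen weak convergence $Y_n\rightsquigarrow Y$ (with $Y$ Borel measurable, $Y_n$ possibly nonmeasurable) means $\mathbb E^{*}\varphi(Y_n)\to\mathbb E\varphi(Y)$ for every bounded continuous real $\varphi$. Maps $\hat f_n$ are regarded as $\ell^\infty(X)$-valued after modification on a null set. *)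

theory Defs
  imports "HOL-Probability.Probability"
begin

section \<open>Outer expectation, outer probability and weak convergence\<close>

text \<open>
  Extended-real expectations.  The expectation of a measurable \<open>V\<close> exists iff the integrals of
  its positive part and of its negative part are not both infinite; it may then be infinite.
  Note that \<^const>\<open>e2ennreal\<close> truncates negative arguments to 0, so \<open>e2ennreal (V \<omega>)\<close> is the
  positive part.
\<close>

definition has_expectation :: "'w measure \<Rightarrow> ('w \<Rightarrow> ereal) \<Rightarrow> bool" where
  "has_expectation M V \<longleftrightarrow> V \<in> borel_measurable M \<and>
     ((\<integral>\<^sup>+\<omega>. e2ennreal (V \<omega>) \<partial>M) < \<infinity> \<or> (\<integral>\<^sup>+\<omega>. e2ennreal (- V \<omega>) \<partial>M) < \<infinity>)"

definition expect :: "'w measure \<Rightarrow> ('w \<Rightarrow> ereal) \<Rightarrow> ereal" where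
  "expect M V = enn2ereal (\<integral>\<^sup>+\<omega>. e2ennreal (V \<omega>) \<partial>M) - enn2ereal (\<integral>\<^sup>+\<omega>. e2ennreal (- V \<omega>) \<partial>M)"

definition outer_expect :: "'w measure \<Rightarrow> ('w \<Rightarrow> ereal) \<Rightarrow> ereal" where
  "outer_expect M U = Inf {expect M V | V. has_expectation M V \<and> (\<forall>\<omega>\<in>space M. U \<omega> \<le> V \<omega>)}"

definition outer_prob :: "'w measure \<Rightarrow> 'w set \<Rightarrow> ereal" where
  "outer_prob M A = outer_expect M (indicator A)"

definition bigO_outer_prob :: "'w measure \<Rightarrow> (nat \<Rightarrow> 'w \<Rightarrow> ereal) \<Rightarrow> (nat \<Rightarrow> real) \<Rightarrow> bool" where
  "bigO_outer_prob M U r \<longleftrightarrow>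
     (\<forall>\<epsilon>::real. \<epsilon> > 0 \<longrightarrow> (\<exists>K::real.
        limsup (\<lambda>n. outer_prob M {\<omega> \<in> space M. \<bar>U n \<omega>\<bar> > ereal (K * r n)}) \<le> ereal \<epsilon>))"

definition borel_of :: "'b topology \<Rightarrow> 'b measure" where
  "borel_of T = sigma (topspace T) {U. openin T U}"

text \<open>
  Hoffmann-Jorgensen weak convergence in \<open>T\<close> of arbitrary maps \<open>Y n\<close> on \<open>M\<close> to a Borel measurable
  \<open>Z\<close>, which may live on a different probability space \<open>N\<close>.
\<close>

definition weakly_converges ::
  "'b topology \<Rightarrow> 'w measure \<Rightarrow> (nat \<Rightarrow> 'w \<Rightarrow> 'b) \<Rightarrow> 'v measure \<Rightarrow> ('v \<Rightarrow> 'b) \<Rightarrow> bool" where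
  "weakly_converges T M Y N Z \<longleftrightarrow>
     (\<forall>n. Y n \<in> space M \<rightarrow> topspace T) \<and>
     Z \<in> measurable N (borel_of T) \<and>
     (\<forall>\<phi>. continuous_map T euclideanreal \<phi> \<and> bounded (\<phi> ` topspace T) \<longrightarrow>
        (\<lambda>n. outer_expect M (\<lambda>\<omega>. ereal (\<phi> (Y n \<omega>)))) \<longlonglongrightarrow> ereal (\<integral>\<omega>. \<phi> (Z \<omega>) \<partial>N))"

section \<open>Bounded functions\<close>

text \<open>
  The bounded real functions on \<open>X\<close> with the supremum distance.  As usual for functions on a
  carrier set, the elements are extensional, i.e. \<^const>\<open>undefined\<close> outside \<open>X\<close>.
\<close>

definition linf :: "'a set \<Rightarrow> ('a \<Rightarrow> real) metric" where
  "linf X = metric (Metric_space.fspace UNIV dist X, Metric_space.fdist UNIV dist X)"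

text \<open>
  Makes a pointwise defined function an element of \<open>linf X\<close>; unbounded functions are replaced by 0.
  For a random function that is almost surely bounded this is a modification on a null set.
\<close>

definition linf_version :: "'a set \<Rightarrow> ('a \<Rightarrow> real) \<Rightarrow> 'a \<Rightarrow> real" where
  "linf_version X g =
     (if restrict g X \<in> mspace (linf X) then restrict g X else (\<lambda>x\<in>X. 0))"

section \<open>Stochastic programs and their empirical counterparts\<close>

text \<open>
  The samples are \<open>\<xi> 1, \<xi> 2, \<dots>\<close>, and \<open>\<xi> 0\<close> is the generic random element.
\<close>

definition obj :: "'w measure \<Rightarrow> (nat \<Rightarrow> 'w \<Rightarrow> 's) \<Rightarrow> ('a \<Rightarrow> 's \<Rightarrow> real) \<Rightarrow> 'a \<Rightarrow> real" where
  "obj M \<xi> h x = (\<integral>\<omega>. h x (\<xi> 0 \<omega>) \<partial>M)"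

definition emp_obj :: "(nat \<Rightarrow> 'w \<Rightarrow> 's) \<Rightarrow> ('a \<Rightarrow> 's \<Rightarrow> real) \<Rightarrow> nat \<Rightarrow> 'w \<Rightarrow> 'a \<Rightarrow> real" where
  "emp_obj \<xi> h n \<omega> x = (1 / real n) * (\<Sum>i=1..n. h x (\<xi> i \<omega>))"

text \<open>
  The infimum is taken in the extended reals, since an empirical objective may be unbounded below
  (for small sample sizes, or on a null set); in that case there are no near-minimizers.
\<close>

definition inf_val :: "'a set \<Rightarrow> ('a \<Rightarrow> real) \<Rightarrow> ereal" where
  "inf_val X g = (INF x\<in>X. ereal (g x))"

definition near_min :: "'a set \<Rightarrow> ('a \<Rightarrow> real) \<Rightarrow> real \<Rightarrow> 'a set" where
  "near_min X g \<epsilon> = {x \<in> X. ereal (g x) \<le> inf_val X g + ereal \<epsilon>}"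

definition emp_min_membership ::
  "'w measure \<Rightarrow> 'a set \<Rightarrow> (nat \<Rightarrow> 'w \<Rightarrow> 's) \<Rightarrow> ('a \<Rightarrow> 's \<Rightarrow> real) \<Rightarrow>
   (nat \<Rightarrow> real) \<Rightarrow> (nat \<Rightarrow> 'w \<Rightarrow> 'a) \<Rightarrow> bool" where
  "emp_min_membership M X \<xi> h \<delta> xhat \<longleftrightarrow>
     (\<exists>A :: nat \<Rightarrow> 'w set.
        (\<forall>N\<ge>1. A N \<in> sets M \<and> A N \<subseteq> A (Suc N)) \<and>
        measure M (\<Union>N\<in>{1..}. A N) = 1 \<and>
        (\<forall>N\<ge>1. \<forall>\<omega>\<in>A N. \<forall>n\<ge>N. xhat n \<omega> \<in> near_min X (emp_obj \<xi> h n \<omega>) (\<delta> n)))"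

text \<open>
  Sharp growth presupposes that \<open>X\<close> is a set of points of a Euclidean space.  As the points of \<open>X\<close>
  have an arbitrary type here, this is expressed by an injection \<open>e\<close> of \<open>X\<close> into that space, through
  which distances are measured; for \<open>X \<subseteq> real ^ 'd\<close> one takes the identity.
\<close>

definition sharp_growth ::
  "('a \<Rightarrow> real ^ 'd) \<Rightarrow> 'a set \<Rightarrow> ('a \<Rightarrow> real) \<Rightarrow> real \<Rightarrow> bool" where
  "sharp_growth e X f \<kappa> \<longleftrightarrow>
     inj_on e X \<and> near_min X f 0 \<noteq> {} \<and>
     (\<exists>\<alpha>>0. \<forall>x\<in>X. ereal (f x) - inf_val X f \<ge>
        ereal (\<alpha> * infdist (e x) (e ` near_min X f 0) powr \<kappa>))"

end

theory Submission
  imports Defs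
begin

text \<open>
  With \<open>\<psi> = inf f\<close>, the scaled error of the optimal value is \<open>\<Psi>\<^sub>s(G\<^sub>n)\<close> for \<open>s = \<surd>n\<close>, where
  \<open>G\<^sub>n\<close> is the scaled empirical process and \<open>\<Psi>\<^sub>s(g) = inf\<^sub>x (s (f x - \<psi>) + g x)\<close>.  As \<open>s\<close> grows,
  \<open>\<Psi>\<^sub>s\<close> increases to the directional derivative \<open>\<Phi>(g) = lim\<^sub>\<epsilon> inf {g x | x \<in> S\<^sup>\<epsilon>}\<close>, and all these
  functionals are 1-Lipschitz.  For a bounded continuous \<open>\<phi>\<close> and fixed \<open>k\<close>, the value \<open>\<phi>(\<Psi>\<^sub>s(G\<^sub>n))\<close> is
  therefore eventually at most the supremum of \<open>\<phi>\<close> on the interval from \<open>\<Psi>\<^sub>k(G\<^sub>n)\<close> to \<open>\<Phi>(G\<^sub>n)\<close>, which is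
  a bounded continuous function of \<open>G\<^sub>n\<close>.  Weak convergence applies to it, and dominated convergence as
  \<open>k\<close> grows yields the upper bound; replacing \<open>\<phi>\<close> by \<open>-\<phi>\<close> yields the lower one.  Monotonicity in \<open>s\<close>
  thus replaces the almost sure representation in the usual delta method, so that \<open>G\<close> need not be
  separable.  The rates follow from the tightness of the norms of \<open>G\<^sub>n\<close>.
\<close>

section \<open>Outer probability\<close>

text \<open>A measurable majorant of \<open>V\<close> becomes one of \<open>U\<close> when it is set
  to infinity on a measurable null set containing the exceptional points, and this leaves its
  expectation unchanged. Hence modifications on null sets do not affect outer expectations.\<close>

lemma outer_expect_mono_AE:
  assumes "AE \<omega> in M. U \<omega> \<le> V \<omega>"
  shows "outer_expect M U \<le> outer_expect M V"
  unfolding outer_expect_def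
proof (rule Inf_mono)
  fix b assume "b \<in> {expect M W | W. has_expectation M W \<and> (\<forall>\<omega>\<in>space M. V \<omega> \<le> W \<omega>)}"
  then obtain W where W: "b = expect M W" "has_expectation M W" "\<And>\<omega>. \<omega> \<in> space M \<Longrightarrow> V \<omega> \<le> W \<omega>"
    by blast
  have [measurable]: "W \<in> borel_measurable M"
    using W(2) by (simp add: has_expectation_def)
  obtain A where A: "{\<omega> \<in> space M. \<not> U \<omega> \<le> V \<omega>} \<subseteq> A" "emeasure M A = 0" "A \<in> sets M"
    using AE_E[OF assms] by blast
  define W' where "W' \<omega> = (if \<omega> \<in> A then \<infinity> else W \<omega>)" for \<omega>
  have [measurable]: "W' \<in> borel_measurable M"
    unfolding W'_def using A(3) by measurable
  have ae: "AE \<omega> in M. W' \<omega> = W \<omega>"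
    by (rule AE_I[OF _ A(2,3)]) (auto simp: W'_def)
  have "(\<integral>\<^sup>+\<omega>. e2ennreal (W' \<omega>) \<partial>M) = (\<integral>\<^sup>+\<omega>. e2ennreal (W \<omega>) \<partial>M)"
    "(\<integral>\<^sup>+\<omega>. e2ennreal (- W' \<omega>) \<partial>M) = (\<integral>\<^sup>+\<omega>. e2ennreal (- W \<omega>) \<partial>M)"
    by (intro nn_integral_cong_AE; use ae in \<open>auto\<close>)+
  then have "expect M W' = b" "has_expectation M W'"
    using W(1,2) by (auto simp: expect_def has_expectation_def)
  moreover have "U \<omega> \<le> W' \<omega>" if "\<omega> \<in> space M" for \<omega>
    using A(1) W(3)[OF that] that by (cases "\<omega> \<in> A") (auto simp: W'_def intro: order.trans)
  ultimately show "\<exists>a\<in>{expect M W | W. has_expectation M W \<and> (\<forall>\<omega>\<in>space M. U \<omega> \<le> W \<omega>)}. a \<le> b"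
    by blast
qed

lemma outer_expect_le_expect:
  assumes "has_expectation M V" "\<And>\<omega>. \<omega> \<in> space M \<Longrightarrow> U \<omega> \<le> V \<omega>"
  shows "outer_expect M U \<le> expect M V"
  unfolding outer_expect_def using assms by (intro Inf_lower) blast

lemma e2ennreal_indicator: "e2ennreal (indicator A \<omega>) = indicator A \<omega>"
  by (auto simp: indicator_def one_ereal_def zero_ereal_def simp flip: ennreal_1)

lemma (in prob_space) outer_prob_le_prob:
  assumes "B \<in> events" "A \<inter> space M \<subseteq> B"
  shows "outer_prob M A \<le> ereal (prob B)"
proof -
  have pos: "(\<integral>\<^sup>+\<omega>. e2ennreal (indicator B \<omega>) \<partial>M) = ennreal (prob B)"
    using assms(1) by (simp add: e2ennreal_indicator emeasure_eq_measure)
  have neg: "(\<integral>\<^sup>+\<omega>. e2ennreal (- indicator B \<omega>) \<partial>M) = 0"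
    by (simp add: e2ennreal_neg)
  have "has_expectation M (indicator B)"
    using assms(1) pos neg by (auto simp: has_expectation_def)
  then have "outer_prob M A \<le> expect M (indicator B)"
    unfolding outer_prob_def using assms(2)
    by (intro outer_expect_le_expect) (auto simp: indicator_def)
  also have "\<dots> = ereal (prob B)"
    by (simp add: expect_def pos neg zero_ennreal.rep_eq)
  finally show ?thesis .
qed

text \<open>This is Markov's inequality: if a measurable \<open>V\<close> majorizes the indicator of
  \<open>A\<close>, then the event \<open>V >= 1\<close> covers \<open>A\<close>, and its
  probability is at most the expectation of \<open>V\<close>. It replaces outer probabilities by
  measurable covers, to which subadditivity of \<open>prob\<close> applies.\<close>

lemma (in prob_space) outer_prob_less_iff:
  "outer_prob M A < ereal c \<longleftrightarrow> (\<exists>B\<in>events. A \<inter> space M \<subseteq> B \<and> prob B < c)"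
proof
  assume "outer_prob M A < ereal c"
  then obtain V where V: "has_expectation M V" "expect M V < ereal c"
      "\<And>\<omega>. \<omega> \<in> space M \<Longrightarrow> indicator A \<omega> \<le> V \<omega>"
    unfolding outer_prob_def outer_expect_def Inf_less_iff by blast
  have [measurable]: "V \<in> borel_measurable M"
    using V(1) by (simp add: has_expectation_def)
  have nonneg: "0 \<le> V \<omega>" if "\<omega> \<in> space M" for \<omega>
    using V(3)[OF that] by (metis ereal_indicator_nonneg order.trans)
  define B where "B = {\<omega> \<in> space M. 1 \<le> V \<omega>}"
  have [measurable]: "B \<in> events"
    unfolding B_def by measurable
  have "(\<integral>\<^sup>+\<omega>. e2ennreal (- V \<omega>) \<partial>M) = (\<integral>\<^sup>+\<omega>. 0 \<partial>M)"
    by (intro nn_integral_cong e2ennreal_neg) (use nonneg in auto)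
  then have neg: "(\<integral>\<^sup>+\<omega>. e2ennreal (- V \<omega>) \<partial>M) = 0"
    by simp
  have "emeasure M B = (\<integral>\<^sup>+\<omega>. indicator B \<omega> \<partial>M)"
    by simp
  also have "\<dots> \<le> (\<integral>\<^sup>+\<omega>. e2ennreal (V \<omega>) \<partial>M)"
  proof (rule nn_integral_mono)
    fix \<omega> assume "\<omega> \<in> space M"
    show "indicator B \<omega> \<le> e2ennreal (V \<omega>)"
      using e2ennreal_mono[of 1 "V \<omega>"] by (auto simp: indicator_def B_def one_ereal_def)
  qed
  finally have "ereal (prob B) \<le> expect M V"
    unfolding expect_def neg emeasure_eq_measure
    by (simp add: less_eq_ennreal.rep_eq zero_ennreal.rep_eq)
  then have "prob B < c"
    using V(2) by (metis ereal_less_eq(3) leD leI order.trans)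
  moreover have "A \<inter> space M \<subseteq> B"
    using V(3) by (force simp: B_def indicator_def)
  ultimately show "\<exists>B\<in>events. A \<inter> space M \<subseteq> B \<and> prob B < c"
    by auto
next
  assume "\<exists>B\<in>events. A \<inter> space M \<subseteq> B \<and> prob B < c"
  then show "outer_prob M A < ereal c"
    using outer_prob_le_prob by (meson less_ereal.simps(1) order.strict_trans1)
qed

text \<open>All rates are derived through this rule. Up to a null set, \<open>U n\<close> can exceed
  its bound only where \<open>g n > K\<close> or outside \<open>E n\<close>, and each of these costs
  at most half of the allowed probability for large \<open>n\<close>. The events \<open>E n\<close>
  leave room for near-minimality that holds only with probability tending to 1.\<close>

lemma (in prob_space) bigO_outer_probI:
  fixes g :: "nat \<Rightarrow> 'a \<Rightarrow> real"
  assumes tight: "\<And>\<epsilon>. \<epsilon> > 0 \<Longrightarrow> \<exists>K. \<forall>\<^sub>F n in sequentially. outer_prob M {\<omega> \<in> space M. g n \<omega> > K} < ereal \<epsilon>"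
    and E: "\<And>n. E n \<in> events" "(\<lambda>n. prob (E n)) \<longlonglongrightarrow> 1"
    and bound: "\<And>K. \<exists>C. \<forall>\<^sub>F n in sequentially. AE \<omega> in M. \<omega> \<in> E n \<longrightarrow> g n \<omega> \<le> K \<longrightarrow> \<bar>U n \<omega>\<bar> \<le> ereal (C * r n)"
  shows "bigO_outer_prob M U r"
  unfolding bigO_outer_prob_def
proof (intro allI impI)
  fix \<epsilon> :: real assume "\<epsilon> > 0"
  obtain K where K: "\<forall>\<^sub>F n in sequentially. outer_prob M {\<omega> \<in> space M. g n \<omega> > K} < ereal (\<epsilon> / 2)"
    using tight[of "\<epsilon> / 2"] \<open>\<epsilon> > 0\<close> by auto
  obtain C where C: "\<forall>\<^sub>F n in sequentially. AE \<omega> in M. \<omega> \<in> E n \<longrightarrow> g n \<omega> \<le> K \<longrightarrow> \<bar>U n \<omega>\<bar> \<le> ereal (C * r n)"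
    using bound by blast
  have "\<forall>\<^sub>F n in sequentially. prob (E n) > 1 - \<epsilon> / 2"
    using order_tendstoD(1)[OF E(2)] \<open>\<epsilon> > 0\<close> by simp
  then have "\<forall>\<^sub>F n in sequentially. outer_prob M {\<omega> \<in> space M. \<bar>U n \<omega>\<bar> > ereal (C * r n)} \<le> ereal \<epsilon>"
    using K C
  proof eventually_elim
    case (elim n)
    obtain B where B: "B \<in> events" "{\<omega> \<in> space M. g n \<omega> > K} \<inter> space M \<subseteq> B" "prob B < \<epsilon> / 2"
      using elim(2) unfolding outer_prob_less_iff by blast
    have "outer_prob M {\<omega> \<in> space M. \<bar>U n \<omega>\<bar> > ereal (C * r n)} \<le> outer_prob M (B \<union> (space M - E n))"
      unfolding outer_prob_def
    proof (rule outer_expect_mono_AE)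
      show "AE \<omega> in M. (indicator {\<omega> \<in> space M. \<bar>U n \<omega>\<bar> > ereal (C * r n)} \<omega> :: ereal)
              \<le> indicator (B \<union> (space M - E n)) \<omega>"
        using elim(3) AE_space
      proof eventually_elim
        case (elim \<omega>)
        then show ?case
          using B(2) by (auto simp: indicator_def not_less)
      qed
    qed
    also have "\<dots> \<le> ereal (prob (B \<union> (space M - E n)))"
      using B(1) E(1) by (intro outer_prob_le_prob) auto
    also have "prob (B \<union> (space M - E n)) \<le> prob B + prob (space M - E n)"
      using B(1) E(1) by (intro measure_Un_le) auto
    also have "prob (space M - E n) = 1 - prob (E n)"
      using E(1) by (simp add: prob_compl)
    finally show ?case
      using elim(1) B(3) by (auto elim: order.trans)
  qed
  then show "\<exists>K. limsup (\<lambda>n. outer_prob M {\<omega> \<in> space M. \<bar>U n \<omega>\<bar> > ereal (K * r n)}) \<le> ereal \<epsilon>"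
    by (blast intro: Limsup_bounded)
qed

section \<open>Continuous functionals on bounded functions\<close>

lemma linf_eq_funspace: "linf X = funspace X euclidean_metric"
  by (simp add: linf_def funspace_def)

lemma mspace_linf: "mspace (linf X) = {g. g \<in> extensional X \<and> bounded (g ` X)}"
  by (auto simp: linf_eq_funspace Met_TC.fspace_def)

lemma restrict_in_linf_iff: "restrict g X \<in> mspace (linf X) \<longleftrightarrow> bounded (g ` X)"
  by (simp add: mspace_linf)

lemma mdist_linf_le_iff:
  assumes "g \<in> mspace (linf X)" "g' \<in> mspace (linf X)" "X \<noteq> {}"
  shows "mdist (linf X) g g' \<le> a \<longleftrightarrow> (\<forall>x\<in>X. \<bar>g x - g' x\<bar> \<le> a)"
  using assms by (simp add: linf_eq_funspace Met_TC.funspace_mdist_le dist_real_def)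

lemma abs_diff_le_mdist_linf:
  assumes "g \<in> mspace (linf X)" "g' \<in> mspace (linf X)" "x \<in> X"
  shows "\<bar>g x - g' x\<bar> \<le> mdist (linf X) g g'"
  using mdist_linf_le_iff[OF assms(1,2)] assms(3) by blast

text \<open>A one-sided estimate suffices, because exchanging \<open>g\<close> and \<open>g'\<close>
  yields the other side.\<close>

lemma continuous_map_linf_if_1_Lipschitz:
  fixes F :: "('a \<Rightarrow> real) \<Rightarrow> real"
  assumes "\<And>g g'. g \<in> mspace (linf X) \<Longrightarrow> g' \<in> mspace (linf X) \<Longrightarrow> F g \<le> F g' + mdist (linf X) g g'"
  shows "continuous_map (mtopology_of (linf X)) euclideanreal F"
proof -
  have "\<bar>F g - F g'\<bar> \<le> mdist (linf X) g g'" if "g \<in> mspace (linf X)" "g' \<in> mspace (linf X)" for g g'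
    using assms[OF that] assms[OF that(2,1)] by (simp add: mdist_commute)
  then have "Lipschitz_continuous_map (linf X) euclidean_metric F"
    unfolding Lipschitz_continuous_map_def by (auto simp: dist_real_def intro!: exI[of _ 1])
  then show ?thesis
    using Lipschitz_continuous_imp_continuous_map by fastforce
qed

section \<open>Borel measurability of continuous functionals\<close>

lemma space_borel_of [simp]: "space (borel_of T) = topspace T"
  unfolding borel_of_def using openin_subset by (subst space_measure_of) auto

lemma borel_of_euclidean: "borel_of euclidean = borel"
  by (simp add: borel_of_def borel_def)

lemma continuous_map_measurable_borel_of:
  fixes \<phi> :: "'b \<Rightarrow> 'c :: topological_space"
  assumes "Z \<in> measurable N (borel_of T)" "continuous_map T euclidean \<phi>"
  shows "(\<lambda>\<omega>. \<phi> (Z \<omega>)) \<in> borel_measurable N"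
proof -
  have "\<phi> \<in> borel_measurable (borel_of T)"
  proof (rule borel_measurableI)
    fix S :: "'c set" assume "open S"
    then have "openin T {x \<in> topspace T. \<phi> x \<in> S}"
      using assms(2) by (simp add: continuous_map_def)
    moreover have "\<phi> -` S \<inter> topspace T = {x \<in> topspace T. \<phi> x \<in> S}"
      by auto
    ultimately show "\<phi> -` S \<inter> space (borel_of T) \<in> sets (borel_of T)"
      unfolding space_borel_of unfolding borel_of_def
      by (subst sets_measure_of) (auto dest: openin_subset)
  qed
  then show ?thesis
    using assms(1) by (rule measurable_compose_rev)
qed

text \<open>The segment is never empty and does not depend on the order of its endpoints, unlike the
  interval from \<open>a\<close> to \<open>b\<close>. This makes the supremum jointly continuous in
  the endpoints without a case distinction.\<close>

definition segment_sup :: "(real \<Rightarrow> real) \<Rightarrow> real \<Rightarrow> real \<Rightarrow> real" where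
  "segment_sup \<phi> a b = (SUP v\<in>closed_segment a b. \<phi> v)"

lemma segment_sup_upper:
  assumes "bounded (range \<phi>)" "v \<in> closed_segment a b"
  shows "\<phi> v \<le> segment_sup \<phi> a b"
  unfolding segment_sup_def
  using assms by (intro cSUP_upper bounded_imp_bdd_above) (auto elim: bounded_subset)

lemma segment_sup_least:
  assumes "\<And>v. v \<in> closed_segment a b \<Longrightarrow> \<phi> v \<le> c"
  shows "segment_sup \<phi> a b \<le> c"
  unfolding segment_sup_def using assms by (intro cSUP_least) auto

lemma bounded_segment_sup:
  assumes "\<And>v. \<bar>\<phi> v\<bar> \<le> B"
  shows "\<bar>segment_sup \<phi> a b\<bar> \<le> B"
proof -
  have "\<phi> a \<le> segment_sup \<phi> a b"
    using assms by (intro segment_sup_upper) (auto simp: bounded_iff)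
  moreover have "segment_sup \<phi> a b \<le> B"
    using assms by (intro segment_sup_least) (simp add: abs_le_iff)
  ultimately show ?thesis
    using assms[of a] by auto
qed

text \<open>Points with equal convex weights on two segments are close when the endpoints are, and
  \<open>\<phi>\<close> is uniformly continuous on compact intervals. The general filter serves both
  continuity on a space and limits along sequences.\<close>

lemma segment_sup_tendsto:
  assumes \<phi>: "continuous_on UNIV \<phi>" "bounded (range \<phi>)"
    and a: "(a \<longlongrightarrow> a0) F" and b: "(b \<longlongrightarrow> b0) F"
  shows "((\<lambda>x. segment_sup \<phi> (a x) (b x)) \<longlongrightarrow> segment_sup \<phi> a0 b0) F"
proof (rule tendstoI)
  fix e :: real assume "e > 0"
  \<comment> \<open>The summand 1 allows each of the two endpoints to move by 1/2, so that all
    segments involved stay in one compact interval.\<close>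
  define R where "R = \<bar>a0\<bar> + \<bar>b0\<bar> + 1"
  have "uniformly_continuous_on {-R..R} \<phi>"
    by (intro compact_uniformly_continuous continuous_on_subset[OF \<phi>(1)]) auto
  then obtain d where d: "d > 0"
    "\<And>v w. v \<in> {-R..R} \<Longrightarrow> w \<in> {-R..R} \<Longrightarrow> dist v w < d \<Longrightarrow> dist (\<phi> v) (\<phi> w) < e / 2"
    unfolding uniformly_continuous_on_def using \<open>e > 0\<close> by (metis half_gt_zero)
  have le: "segment_sup \<phi> p q \<le> segment_sup \<phi> p' q' + e / 2"
    if "\<bar>p\<bar> + \<bar>q\<bar> \<le> R" "\<bar>p'\<bar> + \<bar>q'\<bar> \<le> R" "\<bar>p - p'\<bar> < d" "\<bar>q - q'\<bar> < d" for p q p' q'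
  proof (rule segment_sup_least)
    fix v assume "v \<in> closed_segment p q"
    then obtain u where u: "0 \<le> u" "u \<le> 1" "v = (1 - u) * p + u * q"
      by (auto simp: closed_segment_def)
    \<comment> \<open>\<open>w\<close> is the counterpart of \<open>v\<close> on the other segment,
      with the same weight \<open>u\<close>.\<close>
    define w where "w = (1 - u) * p' + u * q'"
    have w: "w \<in> closed_segment p' q'"
      using u by (auto simp: w_def closed_segment_def)
    have conv: "\<bar>(1 - u) * s + u * t\<bar> \<le> (1 - u) * \<bar>s\<bar> + u * \<bar>t\<bar>" for s t :: real
      using u abs_triangle_ineq[of "(1 - u) * s" "u * t"] by (simp add: abs_mult)
    have "(1 - u) * \<bar>s\<bar> + u * \<bar>t\<bar> \<le> \<bar>s\<bar> + \<bar>t\<bar>" for s t :: real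
      using u by (intro add_mono) (auto intro: mult_left_le_one_le)
    with conv have bd: "\<bar>(1 - u) * s + u * t\<bar> \<le> \<bar>s\<bar> + \<bar>t\<bar>" for s t :: real
      using order.trans by blast
    have "v \<in> {-R..R}" "w \<in> {-R..R}"
      using order.trans[OF bd that(1)] order.trans[OF bd that(2)] u(3)
      unfolding w_def by (auto simp only: abs_le_iff atLeastAtMost_iff)
    moreover have "v - w = (1 - u) * (p - p') + u * (q - q')"
      by (simp add: u(3) w_def algebra_simps)
    then have "dist v w < d"
      using conv[of "p - p'" "q - q'"] convex_bound_lt[of "\<bar>p - p'\<bar>" d "\<bar>q - q'\<bar>" "1 - u" u] that(3,4) u
      by (simp add: dist_real_def)
    ultimately have "dist (\<phi> v) (\<phi> w) < e / 2"
      using d(2) by blast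
    then show "\<phi> v \<le> segment_sup \<phi> p' q' + e / 2"
      using segment_sup_upper[OF \<phi>(2) w] unfolding dist_real_def by linarith
  qed
  have "\<forall>\<^sub>F x in F. dist (a x) a0 < min d (1/2)" "\<forall>\<^sub>F x in F. dist (b x) b0 < min d (1/2)"
    using a b d(1) by (auto intro!: tendstoD simp del: min_less_iff_conj)
  then show "\<forall>\<^sub>F x in F. dist (segment_sup \<phi> (a x) (b x)) (segment_sup \<phi> a0 b0) < e"
  proof eventually_elim
    case (elim x)
    then have near: "\<bar>a x - a0\<bar> < d" "\<bar>b x - b0\<bar> < d" "\<bar>a x - a0\<bar> < 1/2" "\<bar>b x - b0\<bar> < 1/2"
      by (simp_all add: dist_real_def)
    then have "\<bar>a x\<bar> + \<bar>b x\<bar> \<le> R" "\<bar>a0\<bar> + \<bar>b0\<bar> \<le> R"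
      unfolding R_def by linarith+
    with near show ?case
      using le[of "a x" "b x" a0 b0] le[of a0 b0 "a x" "b x"] \<open>e > 0\<close>
      by (simp add: dist_real_def abs_minus_commute)
  qed
qed

lemma continuous_map_segment_sup:
  assumes "continuous_on UNIV \<phi>" "bounded (range \<phi>)"
    and "continuous_map T euclideanreal a" "continuous_map T euclideanreal b"
  shows "continuous_map T euclideanreal (\<lambda>x. segment_sup \<phi> (a x) (b x))"
  using assms(3,4) unfolding continuous_map_atin limitin_canonical_iff
  by (blast intro: segment_sup_tendsto[OF assms(1,2)])

lemma segment_sup_refl: "segment_sup \<phi> a a = \<phi> a"
  by (simp add: segment_sup_def)

section \<open>Penalized infima and the directional derivative of the infimum\<close>

lemma inf_val_eq_INF:
  assumes "X \<noteq> {}" "bounded (f ` X)"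
  shows "inf_val X f = ereal (INF x\<in>X. f x)"
  using ereal_Inf'[of "f ` X"] assms by (simp add: inf_val_def image_comp bounded_imp_bdd_below)

lemma near_min_eq:
  assumes "X \<noteq> {}" "bounded (f ` X)"
  shows "near_min X f \<epsilon> = {x \<in> X. f x \<le> (INF x\<in>X. f x) + \<epsilon>}"
  by (simp add: near_min_def inf_val_eq_INF[OF assms])

lemma near_min_nonempty:
  assumes "X \<noteq> {}" "bounded (f ` X)" "\<epsilon> > 0"
  shows "near_min X f \<epsilon> \<noteq> {}"
proof -
  have "(INF x\<in>X. f x) < (INF x\<in>X. f x) + \<epsilon>"
    using \<open>\<epsilon> > 0\<close> by simp
  then obtain x where "x \<in> X" "f x < (INF x\<in>X. f x) + \<epsilon>"
    using assms by (subst (asm) cINF_less_iff) (auto simp: bounded_imp_bdd_below)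
  then show ?thesis
    by (auto simp: near_min_eq[OF assms(1,2)] intro!: less_imp_le)
qed

lemma INF_le_INF_add:
  fixes g g' :: "'a \<Rightarrow> real"
  assumes "S \<noteq> {}" "bdd_below (g ` S)" "\<And>x. x \<in> S \<Longrightarrow> g x \<le> g' x + d"
  shows "(INF x\<in>S. g x) \<le> (INF x\<in>S. g' x) + d"
proof -
  have "(INF x\<in>S. g x) - d \<le> (INF x\<in>S. g' x)"
    using assms cINF_lower[OF assms(2)]
    by (intro cINF_greatest) (auto simp: le_diff_eq algebra_simps intro: order.trans)
  then show ?thesis
    by simp
qed

text \<open>For \<open>s > 0\<close> this is the difference quotient of the infimum functional at
  \<open>f\<close> in direction \<open>g\<close> with step \<open>1/s\<close>, namely
  \<open>s * (inf (f + g / s) - inf f)\<close>. The form without division displays the nonnegative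
  factor of \<open>s\<close> that makes it monotone.\<close>

definition pen_inf :: "'a set \<Rightarrow> ('a \<Rightarrow> real) \<Rightarrow> real \<Rightarrow> ('a \<Rightarrow> real) \<Rightarrow> real" where
  "pen_inf X f s g = (INF x\<in>X. s * (f x - (INF y\<in>X. f y)) + g x)"

text \<open>The limit of these difference quotients as \<open>s\<close> grows. \<open>Lim\<close> is
  meaningful only where the limit exists, which is shown below for bounded \<open>g\<close>.\<close>

definition dir_inf :: "'a set \<Rightarrow> ('a \<Rightarrow> real) \<Rightarrow> ('a \<Rightarrow> real) \<Rightarrow> real" where
  "dir_inf X f g = Lim (at_right 0) (\<lambda>\<epsilon>. INF x\<in>near_min X f \<epsilon>. g x)"

context
  fixes X :: "'a set" and f :: "'a \<Rightarrow> real"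
  assumes X: "X \<noteq> {}" and f: "bounded (f ` X)"
begin

lemma INF_le: "x \<in> X \<Longrightarrow> (INF y\<in>X. f y) \<le> f x"
  using f by (intro cINF_lower bounded_imp_bdd_below)

lemma bdd_below_penalized:
  fixes g :: "'a \<Rightarrow> real"
  assumes "bounded (g ` X)" "s \<ge> 0"
  shows "bdd_below ((\<lambda>x. s * (f x - (INF y\<in>X. f y)) + g x) ` X)"
proof -
  obtain c where c: "\<And>x. x \<in> X \<Longrightarrow> c \<le> g x"
    using bounded_imp_bdd_below[OF assms(1)] by (auto simp: bdd_below_def)
  show ?thesis
  proof (rule bdd_belowI2)
    fix x assume "x \<in> X"
    then show "c \<le> s * (f x - (INF y\<in>X. f y)) + g x"
      using c[of x] INF_le[of x] assms(2) by (intro add_increasing mult_nonneg_nonneg) auto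
  qed
qed

lemma bdd_below_near_min:
  fixes g :: "'a \<Rightarrow> real"
  assumes "bounded (g ` X)"
  shows "bdd_below (g ` near_min X f \<epsilon>)"
  by (rule bounded_imp_bdd_below[OF bounded_subset[OF assms]]) (auto simp: near_min_def)

lemma pen_inf_le_add_mdist:
  assumes "g \<in> mspace (linf X)" "g' \<in> mspace (linf X)" "s \<ge> 0"
  shows "pen_inf X f s g \<le> pen_inf X f s g' + mdist (linf X) g g'"
  unfolding pen_inf_def
proof (rule INF_le_INF_add[OF X bdd_below_penalized])
  fix x assume "x \<in> X"
  then show "s * (f x - (INF y\<in>X. f y)) + g x \<le> s * (f x - (INF y\<in>X. f y)) + g' x + mdist (linf X) g g'"
    using abs_diff_le_mdist_linf[OF assms(1,2)] by fastforce
qed (use assms in \<open>auto simp: mspace_linf\<close>)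

text \<open>The factor of \<open>s\<close> is an excess over the infimum of \<open>f\<close>, hence
  nonnegative. This lets a fixed integer bound the functionals for all larger scales from
  below.\<close>

lemma pen_inf_mono:
  fixes g :: "'a \<Rightarrow> real"
  assumes "bounded (g ` X)" "0 \<le> s" "s \<le> t"
  shows "pen_inf X f s g \<le> pen_inf X f t g"
  unfolding pen_inf_def
  using assms INF_le by (intro cINF_mono X bdd_below_penalized) (auto intro!: bexI mult_right_mono)

lemma near_min_INF_antimono:
  fixes g :: "'a \<Rightarrow> real"
  assumes "bounded (g ` X)" "0 < \<epsilon>" "\<epsilon> \<le> \<epsilon>'"
  shows "(INF x\<in>near_min X f \<epsilon>'. g x) \<le> (INF x\<in>near_min X f \<epsilon>. g x)"
  by (rule cINF_superset_mono[OF near_min_nonempty[OF X f assms(2)] bdd_below_near_min[OF assms(1)]])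
    (use assms in \<open>auto simp: near_min_eq[OF X f]\<close>)

lemma near_min_INF_le:
  fixes g :: "'a \<Rightarrow> real"
  assumes "\<And>x. x \<in> X \<Longrightarrow> g x \<le> B" "bounded (g ` X)" "0 < \<epsilon>"
  shows "(INF x\<in>near_min X f \<epsilon>. g x) \<le> B"
proof -
  obtain x where "x \<in> near_min X f \<epsilon>"
    using near_min_nonempty[OF X f assms(3)] by blast
  then show ?thesis
    using assms(1)[of x] cINF_lower[OF bdd_below_near_min[OF assms(2)]]
    by (force simp: near_min_def)
qed

lemma
  fixes g :: "'a \<Rightarrow> real"
  assumes "bounded (g ` X)"
  shows near_min_INF_tendsto: "((\<lambda>\<epsilon>. INF x\<in>near_min X f \<epsilon>. g x) \<longlongrightarrow> dir_inf X f g) (at_right 0)" (is "(?m \<longlongrightarrow> _) _")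
    and near_min_INF_le_dir_inf: "0 < \<epsilon> \<Longrightarrow> (INF x\<in>near_min X f \<epsilon>. g x) \<le> dir_inf X f g"
proof -
  obtain B where "\<And>x. x \<in> X \<Longrightarrow> g x \<le> B"
    using bounded_imp_bdd_above[OF assms] by (auto simp: bdd_above_def)
  \<comment> \<open>The infima increase as the tolerance shrinks and are bounded by
    \<open>B\<close>, so their right limit at 0 is their supremum.\<close>
  define L where "L = (SUP \<epsilon>\<in>{0<..}. ?m \<epsilon>)"
  have bdd: "bdd_above (?m ` {0<..})"
    using near_min_INF_le[OF _ assms] \<open>\<And>x. x \<in> X \<Longrightarrow> g x \<le> B\<close> by (intro bdd_aboveI2) auto
  have upper: "?m \<epsilon> \<le> L" if "0 < \<epsilon>" for \<epsilon>
    unfolding L_def using that by (intro cSUP_upper bdd) auto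
  have lim: "(?m \<longlongrightarrow> L) (at_right 0)"
  proof (rule order_tendstoI)
    fix a assume "a < L"
    then obtain \<epsilon> where \<epsilon>: "\<epsilon> > 0" "a < ?m \<epsilon>"
      unfolding L_def by (subst (asm) less_cSUP_iff) (auto intro: bdd)
    then have "a < ?m e" if "0 < e" "e < \<epsilon>" for e
      using near_min_INF_antimono[OF assms that(1), of \<epsilon>] that by simp
    then show "\<forall>\<^sub>F e in at_right 0. a < ?m e"
      using \<epsilon>(1) unfolding eventually_at_right_field by blast
  next
    fix a assume "L < a"
    then show "\<forall>\<^sub>F e in at_right 0. ?m e < a"
      using upper unfolding eventually_at_right_field by (meson gt_ex order.strict_trans1)
  qed
  then have "dir_inf X f g = L"
    unfolding dir_inf_def by (intro tendsto_Lim) simp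
  with lim upper show "(?m \<longlongrightarrow> dir_inf X f g) (at_right 0)" "0 < \<epsilon> \<Longrightarrow> ?m \<epsilon> \<le> dir_inf X f g"
    by auto
qed

lemma dir_inf_le_add_mdist:
  assumes "g \<in> mspace (linf X)" "g' \<in> mspace (linf X)"
  shows "dir_inf X f g \<le> dir_inf X f g' + mdist (linf X) g g'"
proof (rule tendsto_le)
  show "((\<lambda>\<epsilon>. (INF x\<in>near_min X f \<epsilon>. g' x) + mdist (linf X) g g') \<longlongrightarrow> dir_inf X f g' + mdist (linf X) g g') (at_right 0)"
    "((\<lambda>\<epsilon>. INF x\<in>near_min X f \<epsilon>. g x) \<longlongrightarrow> dir_inf X f g) (at_right 0)"
    using assms by (auto simp: mspace_linf intro!: near_min_INF_tendsto tendsto_intros)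
  have "(INF x\<in>near_min X f \<epsilon>. g x) \<le> (INF x\<in>near_min X f \<epsilon>. g' x) + mdist (linf X) g g'" if "\<epsilon> > 0" for \<epsilon>
  proof (rule INF_le_INF_add[OF near_min_nonempty[OF X f that] bdd_below_near_min])
    fix x assume "x \<in> near_min X f \<epsilon>"
    then show "g x \<le> g' x + mdist (linf X) g g'"
      using abs_diff_le_mdist_linf[OF assms, of x] by (auto simp: near_min_def)
  qed (use assms in \<open>auto simp: mspace_linf\<close>)
  then show "\<forall>\<^sub>F \<epsilon> in at_right 0. (INF x\<in>near_min X f \<epsilon>. g x) \<le> (INF x\<in>near_min X f \<epsilon>. g' x) + mdist (linf X) g g'"
    by (simp add: eventually_at_right_less eventually_mono[OF eventually_at_right_less])
qed simp

text \<open>On \<open>near_min X f \<epsilon>\<close> the penalty is at most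
  \<open>s * \<epsilon>\<close>, which vanishes as the tolerance tends to 0 with \<open>s\<close>
  fixed.\<close>

lemma pen_inf_le_dir_inf:
  fixes g :: "'a \<Rightarrow> real"
  assumes "bounded (g ` X)" "0 \<le> s"
  shows "pen_inf X f s g \<le> dir_inf X f g"
proof (rule tendsto_le)
  have "((\<lambda>\<epsilon>. (INF x\<in>near_min X f \<epsilon>. g x) + s * \<epsilon>) \<longlongrightarrow> dir_inf X f g + s * 0) (at_right 0)"
    by (intro tendsto_intros near_min_INF_tendsto assms)
  then show "((\<lambda>\<epsilon>. (INF x\<in>near_min X f \<epsilon>. g x) + s * \<epsilon>) \<longlongrightarrow> dir_inf X f g) (at_right 0)"
    by simp
  show "((\<lambda>_. pen_inf X f s g) \<longlongrightarrow> pen_inf X f s g) (at_right 0)"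
    by simp
  have "pen_inf X f s g \<le> (INF x\<in>near_min X f \<epsilon>. g x) + s * \<epsilon>" if "\<epsilon> > 0" for \<epsilon>
  proof -
    have "pen_inf X f s g - s * \<epsilon> \<le> g x" if x: "x \<in> near_min X f \<epsilon>" for x
    proof -
      have "x \<in> X" "f x - (INF y\<in>X. f y) \<le> \<epsilon>"
        using x by (auto simp: near_min_eq[OF X f])
      moreover have "pen_inf X f s g \<le> s * (f x - (INF y\<in>X. f y)) + g x"
        unfolding pen_inf_def by (intro cINF_lower bdd_below_penalized assms \<open>x \<in> X\<close>)
      ultimately show ?thesis
        using mult_left_mono[OF _ assms(2), of "f x - (INF y\<in>X. f y)" \<epsilon>] by linarith
    qed
    then have "pen_inf X f s g - s * \<epsilon> \<le> (INF x\<in>near_min X f \<epsilon>. g x)"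
      by (intro cINF_greatest near_min_nonempty X f that)
    then show ?thesis
      by simp
  qed
  then show "\<forall>\<^sub>F \<epsilon> in at_right 0. pen_inf X f s g \<le> (INF x\<in>near_min X f \<epsilon>. g x) + s * \<epsilon>"
    by (simp add: eventually_mono[OF eventually_at_right_less])
qed simp

text \<open>
  Outside \<open>near_min X f \<epsilon>\<close> the penalty exceeds \<open>s * \<epsilon>\<close>, which for large \<open>s\<close> outweighs the
  bounded perturbation \<open>g\<close>.
\<close>

lemma pen_inf_tendsto_dir_inf:
  fixes g :: "'a \<Rightarrow> real"
  assumes "bounded (g ` X)"
  shows "((\<lambda>s. pen_inf X f s g) \<longlongrightarrow> dir_inf X f g) at_top"
proof (rule order_tendstoI)
  fix a assume "a < dir_inf X f g"
  then have "\<forall>\<^sub>F \<epsilon> in at_right 0. a < (INF x\<in>near_min X f \<epsilon>. g x) \<and> 0 < \<epsilon>"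
    using order_tendstoD(1)[OF near_min_INF_tendsto[OF assms]]
    by (auto intro: eventually_conj eventually_at_right_less)
  then obtain \<epsilon> where \<epsilon>: "a < (INF x\<in>near_min X f \<epsilon>. g x)" "0 < \<epsilon>"
    using eventually_happens'[OF trivial_limit_at_right_real] by blast
  obtain B where B: "\<And>x. x \<in> X \<Longrightarrow> \<bar>g x\<bar> \<le> B"
    using assms by (auto simp: bounded_iff)
  \<comment> \<open>The threshold makes the penalty outside the near-minimizers at least
    \<open>2 * \<bar>B\<bar>\<close>, which covers the gap between the infimum, at most
    \<open>B\<close>, and \<open>g x\<close>, at least \<open>-B\<close>.\<close>
  have "(INF x\<in>near_min X f \<epsilon>. g x) \<le> pen_inf X f s g" if "2 * \<bar>B\<bar> / \<epsilon> \<le> s" for s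
    unfolding pen_inf_def
  proof (rule cINF_greatest[OF X])
    fix x assume x: "x \<in> X"
    have "0 \<le> s"
      using that \<epsilon>(2) by (intro order.trans[OF _ that]) auto
    show "(INF x\<in>near_min X f \<epsilon>. g x) \<le> s * (f x - (INF y\<in>X. f y)) + g x"
    proof (cases "x \<in> near_min X f \<epsilon>")
      case True
      then show ?thesis
        using cINF_lower[OF bdd_below_near_min[OF assms] True] INF_le[OF x] \<open>0 \<le> s\<close>
          mult_nonneg_nonneg[of s "f x - (INF y\<in>X. f y)"] by linarith
    next
      case False
      then have "\<epsilon> \<le> f x - (INF y\<in>X. f y)"
        using x by (simp add: near_min_eq[OF X f])
      then have "s * \<epsilon> \<le> s * (f x - (INF y\<in>X. f y))"
        using \<open>0 \<le> s\<close> by (rule mult_left_mono)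
      moreover have "2 * \<bar>B\<bar> \<le> s * \<epsilon>"
        using that \<epsilon>(2) by (simp add: pos_divide_le_eq)
      moreover have "(INF x\<in>near_min X f \<epsilon>. g x) \<le> B"
        using B by (intro near_min_INF_le assms \<epsilon>(2)) (auto simp: abs_le_iff)
      ultimately show ?thesis
        using B[OF x] by linarith
    qed
  qed
  then show "\<forall>\<^sub>F s in at_top. a < pen_inf X f s g"
    using \<epsilon>(1) by (intro eventually_at_top_linorderI[of "2 * \<bar>B\<bar> / \<epsilon>"]) force
next
  fix a assume "dir_inf X f g < a"
  then show "\<forall>\<^sub>F s in at_top. pen_inf X f s g < a"
    using pen_inf_le_dir_inf[OF assms] by (intro eventually_at_top_linorderI[of 0]) (force)
qed

text \<open>A delta method for the infimum. \<open>Y n\<close> has to agree with the penalized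
  infimum only almost surely and for large \<open>n\<close>, which matches an empirical objective
  that is bounded only in that sense.\<close>

lemma weakly_converges_pen_inf:
  assumes N: "prob_space N"
    and G: "weakly_converges (mtopology_of (linf X)) M Gn N G"
    and s: "filterlim s at_top sequentially"
    and Y: "\<forall>\<^sub>F n in sequentially. AE \<omega> in M. Y n \<omega> = pen_inf X f (s n) (Gn n \<omega>)"
  shows "weakly_converges euclideanreal M Y N (\<lambda>\<omega>. dir_inf X f (G \<omega>))"
proof -
  interpret N: prob_space N by fact
  let ?T = "mtopology_of (linf X)"
  have Gn: "Gn n \<omega> \<in> mspace (linf X)" if "\<omega> \<in> space M" for n \<omega>
    using G that by (auto simp: weakly_converges_def)
  have G_meas: "G \<in> measurable N (borel_of ?T)"
    using G by (simp add: weakly_converges_def)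
  have G_bdd: "bounded (G \<omega> ` X)" if "\<omega> \<in> space N" for \<omega>
    using measurable_space[OF G_meas that] by (simp add: mspace_linf)
  have cont_pen: "continuous_map ?T euclideanreal (pen_inf X f (real k))" for k
    by (intro continuous_map_linf_if_1_Lipschitz pen_inf_le_add_mdist) auto
  have cont_dir: "continuous_map ?T euclideanreal (dir_inf X f)"
    by (intro continuous_map_linf_if_1_Lipschitz dir_inf_le_add_mdist)
  note dir_meas [measurable] = continuous_map_measurable_borel_of[OF G_meas cont_dir]

  \<comment> \<open>For fixed \<open>k\<close> this test function does not change with
    \<open>n\<close> and depends on \<open>g\<close> through two continuous functionals, so weak
    convergence of \<open>Gn\<close> applies to it.\<close>
  define u where "u \<psi> k g = segment_sup \<psi> (pen_inf X f (real k) g) (dir_inf X f g)" for \<psi> k g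
  have cont_u: "continuous_map ?T euclideanreal (u \<psi> k)"
    if "continuous_on UNIV \<psi>" "bounded (range \<psi>)" for \<psi> k
    unfolding u_def by (intro continuous_map_segment_sup that cont_pen cont_dir)
  \<comment> \<open>As soon as \<open>s n >= k\<close>, monotonicity places \<open>Y n\<close>
    between the endpoints of the segment.\<close>
  have le_u: "\<forall>\<^sub>F n in sequentially. AE \<omega> in M. \<psi> (Y n \<omega>) \<le> u \<psi> k (Gn n \<omega>)"
    if \<psi>: "bounded (range \<psi>)" for \<psi> k
    using Y filterlim_at_top[THEN iffD1, OF s, rule_format, of "real k"]
  proof eventually_elim
    case (elim n)
    show ?case
      using elim(1) AE_space
    proof eventually_elim
      case (elim \<omega>)
      have "bounded (Gn n \<omega> ` X)"
        using Gn[OF elim(2)] by (simp add: mspace_linf)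
      then have "pen_inf X f (real k) (Gn n \<omega>) \<le> Y n \<omega>" "Y n \<omega> \<le> dir_inf X f (Gn n \<omega>)"
        unfolding elim(1) using \<open>real k \<le> s n\<close>
        by (auto intro!: pen_inf_mono pen_inf_le_dir_inf intro: order.trans)
      then show ?case
        unfolding u_def by (intro segment_sup_upper \<psi>) (auto simp: closed_segment_eq_real_ivl)
    qed
  qed
  \<comment> \<open>As \<open>k\<close> grows, the segment shrinks to the single point
    \<open>dir_inf X f (G \<omega>)\<close>; the bound of \<open>\<psi>\<close> dominates.\<close>
  have lim_u: "(\<lambda>k. \<integral>\<omega>. u \<psi> k (G \<omega>) \<partial>N) \<longlonglongrightarrow> (\<integral>\<omega>. \<psi> (dir_inf X f (G \<omega>)) \<partial>N)"
    if \<psi>: "continuous_on UNIV \<psi>" "bounded (range \<psi>)" for \<psi>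
  proof -
    obtain B where B: "\<And>v. \<bar>\<psi> v\<bar> \<le> B"
      using \<psi>(2) by (auto simp: bounded_iff)
    show ?thesis
    proof (rule integral_dominated_convergence[where w="\<lambda>_. B"])
      show "(\<lambda>\<omega>. \<psi> (dir_inf X f (G \<omega>))) \<in> borel_measurable N"
        using borel_measurable_continuous_onI[OF \<psi>(1)] by measurable
      show "(\<lambda>\<omega>. u \<psi> k (G \<omega>)) \<in> borel_measurable N" for k
        by (rule continuous_map_measurable_borel_of[OF G_meas cont_u[OF \<psi>]])
      show "AE \<omega> in N. (\<lambda>k. u \<psi> k (G \<omega>)) \<longlonglongrightarrow> \<psi> (dir_inf X f (G \<omega>))"
      proof (rule AE_I2)
        fix \<omega> assume "\<omega> \<in> space N"
        then have "(\<lambda>k. pen_inf X f (real k) (G \<omega>)) \<longlonglongrightarrow> dir_inf X f (G \<omega>)"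
          by (intro filterlim_compose[OF pen_inf_tendsto_dir_inf filterlim_real_sequentially] G_bdd)
        then show "(\<lambda>k. u \<psi> k (G \<omega>)) \<longlonglongrightarrow> \<psi> (dir_inf X f (G \<omega>))"
          using segment_sup_tendsto[OF \<psi> _ tendsto_const] unfolding u_def
          by (metis segment_sup_refl)
      qed
      show "AE \<omega> in N. norm (u \<psi> k (G \<omega>)) \<le> B" for k
        unfolding u_def using bounded_segment_sup[OF B] by simp
    qed simp
  qed
  have conv: "(\<lambda>n. outer_expect M (\<lambda>\<omega>. ereal (\<phi> (Gn n \<omega>)))) \<longlonglongrightarrow> ereal (\<integral>\<omega>. \<phi> (G \<omega>) \<partial>N)"
    if "continuous_map ?T euclideanreal \<phi>" "\<And>g. \<bar>\<phi> g\<bar> \<le> B" for \<phi> B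
  proof -
    have "bounded (\<phi> ` topspace ?T)"
      using that(2) by (auto simp: bounded_iff)
    then show ?thesis
      using G that(1) unfolding weakly_converges_def by blast
  qed

  have "(\<lambda>n. outer_expect M (\<lambda>\<omega>. ereal (\<phi> (Y n \<omega>)))) \<longlonglongrightarrow> ereal (\<integral>\<omega>. \<phi> (dir_inf X f (G \<omega>)) \<partial>N)"
    if \<phi>: "continuous_on UNIV \<phi>" "bounded (range \<phi>)" for \<phi>
  proof (rule order_tendstoI)
    obtain B where B: "\<And>v. \<bar>\<phi> v\<bar> \<le> B"
      using \<phi>(2) by (auto simp: bounded_iff)
    {
      fix a :: ereal assume a: "ereal (\<integral>\<omega>. \<phi> (dir_inf X f (G \<omega>)) \<partial>N) < a"
      have "(\<lambda>k. ereal (\<integral>\<omega>. u \<phi> k (G \<omega>) \<partial>N)) \<longlonglongrightarrow> ereal (\<integral>\<omega>. \<phi> (dir_inf X f (G \<omega>)) \<partial>N)"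
        using lim_u[OF \<phi>] by simp
      \<comment> \<open>\<open>k\<close> is chosen before \<open>n\<close>: the integral at
        \<open>G\<close> is below \<open>a\<close> for this \<open>k\<close>, and weak convergence
        then carries the strict inequality over to all large \<open>n\<close>.\<close>
      from eventually_happens[OF order_tendstoD(2)[OF this a]]
      obtain k where k: "ereal (\<integral>\<omega>. u \<phi> k (G \<omega>) \<partial>N) < a"
        by auto
      have "\<forall>\<^sub>F n in sequentially. outer_expect M (\<lambda>\<omega>. ereal (u \<phi> k (Gn n \<omega>))) < a"
        by (intro order_tendstoD(2)[OF conv k] cont_u \<phi>) (auto simp: u_def intro!: bounded_segment_sup B)
      then show "\<forall>\<^sub>F n in sequentially. outer_expect M (\<lambda>\<omega>. ereal (\<phi> (Y n \<omega>))) < a"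
        using le_u[OF \<phi>(2), of k]
      proof eventually_elim
        case (elim n)
        have "AE \<omega> in M. ereal (\<phi> (Y n \<omega>)) \<le> ereal (u \<phi> k (Gn n \<omega>))"
          using elim(2) by eventually_elim simp
        then show ?case
          by (rule order.strict_trans1[OF outer_expect_mono_AE elim(1)])
      qed
    next
      fix a :: ereal assume a: "a < ereal (\<integral>\<omega>. \<phi> (dir_inf X f (G \<omega>)) \<partial>N)"
      have \<phi>': "continuous_on UNIV (\<lambda>v. - \<phi> v)" "bounded (range (\<lambda>v. - \<phi> v))"
        using \<phi> by (auto intro!: continuous_intros simp: bounded_iff)
      \<comment> \<open>\<open>l k\<close> is the infimum of \<open>\<phi>\<close> over the segment.
        Outer expectation does not commute with negation, so the upper estimate for
        \<open>-\<phi>\<close> cannot simply be negated; weak convergence is applied to the lower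
        bound \<open>l k\<close> itself.\<close>
      define l where "l k g = - u (\<lambda>v. - \<phi> v) k g" for k g
      have "(\<lambda>k. ereal (\<integral>\<omega>. l k (G \<omega>) \<partial>N)) \<longlonglongrightarrow> ereal (\<integral>\<omega>. \<phi> (dir_inf X f (G \<omega>)) \<partial>N)"
        using tendsto_minus[OF lim_u[OF \<phi>']] by (simp add: l_def)
      from eventually_happens[OF order_tendstoD(1)[OF this a]]
      obtain k where k: "a < ereal (\<integral>\<omega>. l k (G \<omega>) \<partial>N)"
        by auto
      have "continuous_map ?T euclideanreal (l k)"
        unfolding l_def by (intro continuous_map_minus cont_u \<phi>')
      then have "\<forall>\<^sub>F n in sequentially. a < outer_expect M (\<lambda>\<omega>. ereal (l k (Gn n \<omega>)))"
        by (rule order_tendstoD(1)[OF conv k]) (auto simp: l_def u_def intro!: bounded_segment_sup B)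
      then show "\<forall>\<^sub>F n in sequentially. a < outer_expect M (\<lambda>\<omega>. ereal (\<phi> (Y n \<omega>)))"
        using le_u[OF \<phi>'(2), of k]
      proof eventually_elim
        case (elim n)
        have "AE \<omega> in M. ereal (l k (Gn n \<omega>)) \<le> ereal (\<phi> (Y n \<omega>))"
          using elim(2) by eventually_elim (simp add: l_def)
        then show ?case
          by (rule order.strict_trans2[OF elim(1) outer_expect_mono_AE])
      qed
    }
  qed
  then show ?thesis
    unfolding weakly_converges_def borel_of_euclidean using dir_meas by simp
qed

end

section \<open>Rates\<close>

text \<open>\<open>F (Z \<omega>)\<close> is a finite real at every point, so the limit has small
  mass far out, and a single bounded continuous test function transfers this to
  \<open>Y n\<close>.\<close>

lemma weakly_converges_imp_tight:
  assumes Y: "weakly_converges T M Y N Z" and N: "prob_space N"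
    and F: "continuous_map T euclideanreal F" and \<epsilon>: "\<epsilon> > 0"
  shows "\<exists>K. \<forall>\<^sub>F n in sequentially. outer_prob M {\<omega> \<in> space M. F (Y n \<omega>) > K} < ereal \<epsilon>"
proof -
  interpret N: prob_space N by fact
  have Z: "Z \<in> measurable N (borel_of T)"
    using Y by (simp add: weakly_converges_def)
  \<comment> \<open>A ramp rising from 0 at \<open>F v = k\<close> to 1 at
    \<open>F v = k + 1\<close>. It is a continuous majorant of the indicator of
    \<open>F v > k + 1\<close>.\<close>
  define c where "c k v = max 0 (min 1 (F v - real k))" for k v
  have cont: "continuous_map T euclideanreal (c k)" for k
    unfolding c_def
    by (intro continuous_map_real_max continuous_map_real_min continuous_map_diff F) auto
  have "(\<lambda>k. \<integral>\<omega>. c k (Z \<omega>) \<partial>N) \<longlonglongrightarrow> (\<integral>\<omega>. 0 \<partial>N)"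
  proof (rule integral_dominated_convergence[where w="\<lambda>_. 1"])
    show "(\<lambda>\<omega>. c k (Z \<omega>)) \<in> borel_measurable N" for k
      by (rule continuous_map_measurable_borel_of[OF Z cont])
    show "AE \<omega> in N. (\<lambda>k. c k (Z \<omega>)) \<longlonglongrightarrow> 0"
    proof (rule AE_I2)
      fix \<omega>
      have "\<forall>\<^sub>F k in sequentially. F (Z \<omega>) \<le> real k"
        using filterlim_real_sequentially by (simp add: filterlim_at_top)
      then show "(\<lambda>k. c k (Z \<omega>)) \<longlonglongrightarrow> 0"
        by (intro tendsto_eventually) (auto elim!: eventually_mono simp: c_def)
    qed
    show "AE \<omega> in N. norm (c k (Z \<omega>)) \<le> 1" for k
      by (auto simp: c_def)
  qed auto
  then have "(\<lambda>k. \<integral>\<omega>. c k (Z \<omega>) \<partial>N) \<longlonglongrightarrow> 0"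
    by simp
  from eventually_happens[OF order_tendstoD(2)[OF this \<epsilon>]]
  obtain k where k: "ereal (\<integral>\<omega>. c k (Z \<omega>) \<partial>N) < ereal \<epsilon>"
    by auto
  have "bounded (c k ` topspace T)"
    by (auto simp: bounded_iff c_def intro!: exI[of _ 1])
  with Y cont have "(\<lambda>n. outer_expect M (\<lambda>\<omega>. ereal (c k (Y n \<omega>)))) \<longlonglongrightarrow> ereal (\<integral>\<omega>. c k (Z \<omega>) \<partial>N)"
    unfolding weakly_converges_def by blast
  from order_tendstoD(2)[OF this k]
  have "\<forall>\<^sub>F n in sequentially. outer_prob M {\<omega> \<in> space M. F (Y n \<omega>) > real k + 1} < ereal \<epsilon>"
  proof eventually_elim
    case (elim n)
    have "outer_prob M {\<omega> \<in> space M. F (Y n \<omega>) > real k + 1} \<le> outer_expect M (\<lambda>\<omega>. ereal (c k (Y n \<omega>)))"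
      unfolding outer_prob_def
      by (intro outer_expect_mono_AE AE_I2)
        (auto simp: indicator_def c_def one_ereal_def zero_ereal_def simp del: ereal_max)
    then show ?case
      using elim by (rule order.strict_trans1)
  qed
  then show ?thesis
    by blast
qed

section \<open>Comparison of infima and near-minimizers under uniform errors\<close>

lemma abs_INF_diff_le:
  fixes g g' :: "'a \<Rightarrow> real"
  assumes "X \<noteq> {}" "bounded (g ` X)" "bounded (g' ` X)" "\<And>x. x \<in> X \<Longrightarrow> \<bar>g x - g' x\<bar> \<le> d"
  shows "\<bar>(INF x\<in>X. g x) - (INF x\<in>X. g' x)\<bar> \<le> d"
proof -
  have "g x \<le> g' x + d" "g' x \<le> g x + d" if "x \<in> X" for x
    using assms(4)[OF that] by auto
  then have "(INF x\<in>X. g x) \<le> (INF x\<in>X. g' x) + d" "(INF x\<in>X. g' x) \<le> (INF x\<in>X. g x) + d"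
    using assms(1-3) by (auto intro!: INF_le_INF_add bounded_imp_bdd_below)
  then show ?thesis
    by simp
qed

text \<open>In the direction \<open>s * (g - f)\<close> the terms with \<open>f x\<close> cancel,
  leaving a nondecreasing continuous affine function of \<open>g x\<close>, which commutes with the
  infimum.\<close>

lemma pen_inf_scaled_diff:
  fixes g f :: "'a \<Rightarrow> real"
  assumes "X \<noteq> {}" "bounded (g ` X)" "s \<ge> 0"
  shows "pen_inf X f s (\<lambda>x\<in>X. s * (g x - f x)) = s * ((INF x\<in>X. g x) - (INF x\<in>X. f x))"
proof -
  let ?A = "\<lambda>v. s * (v - (INF x\<in>X. f x))"
  have "?A (Inf (g ` X)) = Inf (?A ` g ` X)"
    using assms by (intro continuous_at_Inf_mono)
      (auto intro!: monoI mult_left_mono continuous_intros bounded_imp_bdd_below)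
  moreover have "pen_inf X f s (\<lambda>x\<in>X. s * (g x - f x)) = Inf (?A ` g ` X)"
    unfolding pen_inf_def image_image by (intro INF_cong) (auto simp: algebra_simps)
  ultimately show ?thesis
    by simp
qed

text \<open>Taking the event with index \<open>N = n\<close> at sample size \<open>n\<close> gives
  near-minimality there, and continuity from below along the increasing events gives probabilities
  tending to 1.\<close>

lemma emp_min_membership_events:
  assumes "prob_space M" "emp_min_membership M X \<xi> h \<delta> xhat"
  obtains E where "\<And>n. E n \<in> sets M" "(\<lambda>n. measure M (E n)) \<longlonglongrightarrow> 1"
    "\<And>n \<omega>. \<omega> \<in> E n \<Longrightarrow> xhat n \<omega> \<in> near_min X (emp_obj \<xi> h n \<omega>) (\<delta> n)"
proof -
  interpret prob_space M by fact
  obtain A where A: "\<And>n. n \<ge> 1 \<Longrightarrow> A n \<in> events" "\<And>n. n \<ge> 1 \<Longrightarrow> A n \<subseteq> A (Suc n)"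
    "prob (\<Union>n\<in>{1..}. A n) = 1"
    "\<And>m n \<omega>. m \<ge> 1 \<Longrightarrow> \<omega> \<in> A m \<Longrightarrow> m \<le> n \<Longrightarrow> xhat n \<omega> \<in> near_min X (emp_obj \<xi> h n \<omega>) (\<delta> n)"
    using assms(2) unfolding emp_min_membership_def by blast
  \<comment> \<open>The assumption says nothing about \<open>A 0\<close>, so the index 0 receives
    the empty event.\<close>
  define E where "E n = (if n = 0 then {} else A n)" for n
  have "(\<lambda>n. prob (A (Suc n))) \<longlonglongrightarrow> prob (\<Union>n. A (Suc n))"
    using A(1,2) by (intro finite_Lim_measure_incseq) (auto simp: incseq_Suc_iff)
  moreover have "(\<Union>n. A (Suc n)) = (\<Union>n\<in>{1..}. A n)"
    by (auto simp: Suc_le_eq gr0_conv_Suc)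
  ultimately have "(\<lambda>n. prob (E (Suc n))) \<longlonglongrightarrow> 1"
    using A(3) by (simp add: E_def)
  then have "(\<lambda>n. prob (E n)) \<longlonglongrightarrow> 1"
    by (rule LIMSEQ_imp_Suc)
  moreover have "E n \<in> events" for n
    using A(1) by (simp add: E_def)
  moreover have "xhat n \<omega> \<in> near_min X (emp_obj \<xi> h n \<omega>) (\<delta> n)" if "\<omega> \<in> E n" for n \<omega>
    using that A(4)[of n \<omega> n] by (auto simp: E_def split: if_splits)
  ultimately show ?thesis
    using that by blast
qed

text \<open>One \<open>d\<close> is paid for passing from \<open>f x\<close> to \<open>g x\<close>,
  the other for comparing the two infima.\<close>

lemma near_min_imp_excess_le:
  fixes f g :: "'a \<Rightarrow> real"
  assumes "X \<noteq> {}" "bounded (f ` X)" "bounded (g ` X)" "\<And>x. x \<in> X \<Longrightarrow> \<bar>g x - f x\<bar> \<le> d"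
    and "x \<in> near_min X g \<delta>"
  shows "f x - (INF y\<in>X. f y) \<le> 2 * d + \<delta>"
proof -
  have "x \<in> X" "g x \<le> (INF y\<in>X. g y) + \<delta>"
    using assms(5) by (auto simp: near_min_eq[OF assms(1,3)])
  then show ?thesis
    using assms(4)[of x] abs_INF_diff_le[OF assms(1,3,2,4)] by linarith
qed

text \<open>Take roots of order \<open>\<kappa>\<close>. The absolute value keeps the base
  nonnegative, since \<open>C\<close> may have either sign.\<close>

lemma le_of_mult_powr_le:
  fixes t :: real
  assumes "0 < \<alpha>" "0 < \<kappa>" "0 \<le> t" "0 \<le> r" "\<alpha> * t powr \<kappa> \<le> C * r"
  shows "t \<le> (\<bar>C\<bar> / \<alpha>) powr (1 / \<kappa>) * r powr (1 / \<kappa>)"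
proof -
  have "\<alpha> * t powr \<kappa> \<le> \<bar>C\<bar> * r"
    using assms(5) mult_right_mono[OF abs_ge_self assms(4)] by (rule order.trans)
  then have "t powr \<kappa> \<le> \<bar>C\<bar> / \<alpha> * r"
    using assms(1) by (simp add: field_simps)
  then have "(t powr \<kappa>) powr (1 / \<kappa>) \<le> (\<bar>C\<bar> / \<alpha> * r) powr (1 / \<kappa>)"
    using assms(2) by (intro powr_mono2) auto
  moreover have "(t powr \<kappa>) powr (1 / \<kappa>) = t"
    using assms(2,3) by (simp add: powr_powr)
  ultimately show ?thesis
    using assms(1,4) powr_mult[of "\<bar>C\<bar> / \<alpha>" r "1 / \<kappa>"] by simp
qed

section \<open>Weak limit of the optimal value and rates of convergence\<close>

theorem corollary4p5:
  fixes M :: "'w measure" and P :: "'s measure" and \<xi> :: "nat \<Rightarrow> 'w \<Rightarrow> 's"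
    and X :: "'a set" and h :: "'a \<Rightarrow> 's \<Rightarrow> real" and f :: "'a \<Rightarrow> real"
    and N :: "'v measure" and G :: "'v \<Rightarrow> 'a \<Rightarrow> real"
  assumes "prob_space M"
    and "prob_space.indep_vars M (\<lambda>_. P) \<xi> UNIV"
    and "\<And>i. distr M P (\<xi> i) = P"
    and "X \<noteq> {}"
    and "\<And>x. x \<in> X \<Longrightarrow> integrable P (h x)"
    and f_def: "f = obj M \<xi> h"
    and "restrict f X \<in> mspace (linf X)"
    and "\<forall>\<^sub>F n in sequentially. AE \<omega> in M. restrict (emp_obj \<xi> h n \<omega>) X \<in> mspace (linf X)"
    and "prob_space N"
    and "G \<in> measurable N (borel_of (mtopology_of (linf X)))"
    and "weakly_converges (mtopology_of (linf X))
           M (\<lambda>n \<omega>. \<lambda>x\<in>X. sqrt (real n) * (linf_version X (emp_obj \<xi> h n \<omega>) x - f x))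
           N G"
  shows
    "(\<forall>\<omega>\<in>space N. \<exists>L. ((\<lambda>\<epsilon>. INF x\<in>near_min X f \<epsilon>. G \<omega> x) \<longlongrightarrow> L) (at_right 0))
   \<and> weakly_converges euclideanreal
       M (\<lambda>n \<omega>. sqrt (real n) * (real_of_ereal (inf_val X (emp_obj \<xi> h n \<omega>)) - real_of_ereal (inf_val X f)))
       N (\<lambda>\<omega>. Lim (at_right 0) (\<lambda>\<epsilon>. INF x\<in>near_min X f \<epsilon>. G \<omega> x))
   \<and> bigO_outer_prob M (\<lambda>n \<omega>. inf_val X (emp_obj \<xi> h n \<omega>) - inf_val X f)
       (\<lambda>n. real n powr (- 1 / 2))
   \<and> (\<forall>(\<delta> :: nat \<Rightarrow> real) (xhat :: nat \<Rightarrow> 'w \<Rightarrow> 'a).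
        (\<forall>n. \<delta> n \<ge> 0) \<and> \<delta> \<in> O(\<lambda>n. real n powr (- 1 / 2)) \<and>
        (\<forall>n. xhat n \<in> space M \<rightarrow> X) \<and> emp_min_membership M X \<xi> h \<delta> xhat \<longrightarrow>
          bigO_outer_prob M (\<lambda>n \<omega>. ereal (f (xhat n \<omega>)) - inf_val X f)
            (\<lambda>n. real n powr (- 1 / 2)) \<and>
          (\<forall>(\<kappa> :: real) (e :: 'a \<Rightarrow> real ^ 'd). \<kappa> \<ge> 1 \<and> sharp_growth e X f \<kappa> \<longrightarrow>
             bigO_outer_prob M (\<lambda>n \<omega>. ereal (infdist (e (xhat n \<omega>)) (e ` near_min X f 0)))
               (\<lambda>n. real n powr (- 1 / (2 * \<kappa>)))))"
proof -
  interpret prob_space M by fact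
  define Gn where "Gn n \<omega> = (\<lambda>x\<in>X. sqrt (real n) * (linf_version X (emp_obj \<xi> h n \<omega>) x - f x))" for n \<omega>
  \<comment> \<open>The supremum norm of the scaled empirical process, whose tightness drives all
    rates.\<close>
  define D where "D n \<omega> = mdist (linf X) (\<lambda>x\<in>X. 0) (Gn n \<omega>)" for n \<omega>
  define r where "r n = real n powr (- 1 / 2)" for n :: nat
  have r_nonneg: "0 \<le> r n" for n
    by (simp add: r_def)
  have sqrt_r: "sqrt (real n) * r n = 1" if "n \<ge> 1" for n
    using that by (simp add: r_def powr_half_sqrt[symmetric] flip: powr_add)
  note X = \<open>X \<noteq> {}\<close>
  have f: "bounded (f ` X)"
    using assms(7) by (simp add: restrict_in_linf_iff)
  note inf_f = inf_val_eq_INF[OF X f]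
  have Gn: "weakly_converges (mtopology_of (linf X)) M Gn N G"
    using assms(11) unfolding Gn_def .
  have Gn_in: "Gn n \<omega> \<in> mspace (linf X)" if "\<omega> \<in> space M" for n \<omega>
    using Gn that by (auto simp: weakly_converges_def)
  have zero: "(\<lambda>x\<in>X. 0) \<in> mspace (linf X)"
    by (auto simp: restrict_in_linf_iff bounded_iff)

  \<comment> \<open>For large \<open>n\<close> and almost every \<open>\<omega>\<close>,
    \<open>linf_version\<close> leaves the empirical objective unchanged on \<open>X\<close>, and
    undoing the scaling by \<open>sqrt n\<close> gives a uniform error of
    \<open>D n \<omega> * r n\<close>. Requiring \<open>n >= 1\<close> ensures
    \<open>sqrt n * r n = 1\<close>; at 0 the product vanishes.\<close>
  have regular: "\<forall>\<^sub>F n in sequentially. AE \<omega> in M. bounded (emp_obj \<xi> h n \<omega> ` X) \<and>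
      Gn n \<omega> = (\<lambda>x\<in>X. sqrt (real n) * (emp_obj \<xi> h n \<omega> x - f x)) \<and>
      (\<forall>x\<in>X. \<bar>emp_obj \<xi> h n \<omega> x - f x\<bar> \<le> D n \<omega> * r n)"
    using assms(8) eventually_ge_at_top[of 1]
  proof eventually_elim
    case (elim n)
    show ?case
      using elim(1) AE_space
    proof eventually_elim
      case (elim \<omega>)
      then have eq: "Gn n \<omega> = (\<lambda>x\<in>X. sqrt (real n) * (emp_obj \<xi> h n \<omega> x - f x))"
        by (auto simp: Gn_def linf_version_def)
      have "\<bar>emp_obj \<xi> h n \<omega> x - f x\<bar> \<le> D n \<omega> * r n" if "x \<in> X" for x
      proof -
        have "\<bar>Gn n \<omega> x\<bar> \<le> D n \<omega>"
          using abs_diff_le_mdist_linf[OF zero Gn_in[OF elim(2)] that] that by (simp add: D_def)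
        then have "\<bar>Gn n \<omega> x\<bar> * r n \<le> D n \<omega> * r n"
          by (rule mult_right_mono[OF _ r_nonneg])
        moreover have "\<bar>Gn n \<omega> x\<bar> * r n = (sqrt (real n) * r n) * \<bar>emp_obj \<xi> h n \<omega> x - f x\<bar>"
          using that by (simp add: eq abs_mult)
        ultimately show ?thesis
          using sqrt_r[OF \<open>n \<ge> 1\<close>] by simp
      qed
      with eq elim(1) show ?case
        by (simp add: restrict_in_linf_iff)
    qed
  qed

  have "continuous_map (mtopology_of (linf X)) euclideanreal (mdist (linf X) (\<lambda>x\<in>X. 0))"
    using zero by (intro continuous_map_linf_if_1_Lipschitz) (metis mdist_commute mdist_triangle)
  note tight = weakly_converges_imp_tight[OF Gn assms(9) this, folded D_def]

  have lim: "\<exists>L. ((\<lambda>\<epsilon>. INF x\<in>near_min X f \<epsilon>. G \<omega> x) \<longlongrightarrow> L) (at_right 0)" if "\<omega> \<in> space N" for \<omega>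
    using near_min_INF_tendsto[OF X f, of "G \<omega>"] measurable_space[OF assms(10) that]
    by (auto simp: mspace_linf)

  have weak: "weakly_converges euclideanreal
       M (\<lambda>n \<omega>. sqrt (real n) * (real_of_ereal (inf_val X (emp_obj \<xi> h n \<omega>)) - real_of_ereal (inf_val X f)))
       N (\<lambda>\<omega>. Lim (at_right 0) (\<lambda>\<epsilon>. INF x\<in>near_min X f \<epsilon>. G \<omega> x))"
    unfolding dir_inf_def[symmetric]
  proof (rule weakly_converges_pen_inf[OF X f assms(9) Gn])
    show "filterlim (\<lambda>n. sqrt (real n)) at_top sequentially"
      by (rule filterlim_compose[OF sqrt_at_top filterlim_real_sequentially])
    show "\<forall>\<^sub>F n in sequentially. AE \<omega> in M. sqrt (real n) *
        (real_of_ereal (inf_val X (emp_obj \<xi> h n \<omega>)) - real_of_ereal (inf_val X f)) =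
        pen_inf X f (sqrt (real n)) (Gn n \<omega>)"
      using regular
    proof eventually_elim
      case (elim n)
      then show ?case
        by eventually_elim (auto simp: pen_inf_scaled_diff[OF X] inf_val_eq_INF[OF X] inf_f)
    qed
  qed

  have value_rate: "bigO_outer_prob M (\<lambda>n \<omega>. inf_val X (emp_obj \<xi> h n \<omega>) - inf_val X f) r"
  \<comment> \<open>No near-minimizer is involved here, so the events are the whole space.\<close>
  proof (rule bigO_outer_probI[where E="\<lambda>_. space M", OF tight])
    fix K
    have "\<forall>\<^sub>F n in sequentially. AE \<omega> in M. \<omega> \<in> space M \<longrightarrow> D n \<omega> \<le> K \<longrightarrow>
        \<bar>inf_val X (emp_obj \<xi> h n \<omega>) - inf_val X f\<bar> \<le> ereal (K * r n)"
      using regular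
    proof eventually_elim
      case (elim n)
      then show ?case
      proof eventually_elim
        case (elim \<omega>)
        then have "\<bar>(INF x\<in>X. emp_obj \<xi> h n \<omega> x) - (INF x\<in>X. f x)\<bar> \<le> D n \<omega> * r n"
          by (intro abs_INF_diff_le X f) auto
        moreover have "D n \<omega> * r n \<le> K * r n" if "D n \<omega> \<le> K"
          by (rule mult_right_mono[OF that r_nonneg])
        ultimately show ?case
          using elim by (auto simp: inf_val_eq_INF[OF X] inf_f)
      qed
    qed
    then show "\<exists>C. \<forall>\<^sub>F n in sequentially. AE \<omega> in M. \<omega> \<in> space M \<longrightarrow> D n \<omega> \<le> K \<longrightarrow>
        \<bar>inf_val X (emp_obj \<xi> h n \<omega>) - inf_val X f\<bar> \<le> ereal (C * r n)"
      by blast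
  qed (simp_all add: prob_space)

  have minimizer_rates: "bigO_outer_prob M (\<lambda>n \<omega>. ereal (f (xhat n \<omega>)) - inf_val X f) r \<and>
      (\<forall>\<kappa> (e :: 'a \<Rightarrow> real ^ 'd). \<kappa> \<ge> 1 \<and> sharp_growth e X f \<kappa> \<longrightarrow>
         bigO_outer_prob M (\<lambda>n \<omega>. ereal (infdist (e (xhat n \<omega>)) (e ` near_min X f 0)))
           (\<lambda>n. real n powr (- 1 / (2 * \<kappa>))))"
    if \<delta>: "\<delta> \<in> O(r)" and xhat: "\<And>n. xhat n \<in> space M \<rightarrow> X"
      and min: "emp_min_membership M X \<xi> h \<delta> xhat"
    for \<delta> xhat
  proof -
    obtain E where E: "\<And>n. E n \<in> events" "(\<lambda>n. prob (E n)) \<longlonglongrightarrow> 1"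
      "\<And>n \<omega>. \<omega> \<in> E n \<Longrightarrow> xhat n \<omega> \<in> near_min X (emp_obj \<xi> h n \<omega>) (\<delta> n)"
      using emp_min_membership_events[OF assms(1) min] by blast
    obtain c where c: "\<forall>\<^sub>F n in sequentially. norm (\<delta> n) \<le> c * norm (r n)"
      using landau_o.bigE[OF \<delta>] by blast
    \<comment> \<open>The constant combines twice the uniform error, at most
      \<open>2 * K * r n\<close>, with the tolerance \<open>\<delta> n\<close>, at most
      \<open>c * r n\<close>.\<close>
    have excess: "\<forall>\<^sub>F n in sequentially. AE \<omega> in M. \<omega> \<in> E n \<longrightarrow> D n \<omega> \<le> K \<longrightarrow>
        f (xhat n \<omega>) - (INF x\<in>X. f x) \<le> (2 * K + c) * r n" for K
      using regular c
    proof eventually_elim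
      case (elim n)
      have \<delta>_le: "\<delta> n \<le> c * r n"
        using elim(2) r_nonneg[of n] by simp
      show ?case
        using elim(1)
      proof eventually_elim
        case (elim \<omega>)
        show ?case
        proof (intro impI)
          assume "\<omega> \<in> E n" "D n \<omega> \<le> K"
          have "f (xhat n \<omega>) - (INF x\<in>X. f x) \<le> 2 * (D n \<omega> * r n) + \<delta> n"
            using elim E(3)[OF \<open>\<omega> \<in> E n\<close>] by (intro near_min_imp_excess_le[OF X f]) auto
          moreover have "D n \<omega> * r n \<le> K * r n"
            by (rule mult_right_mono[OF \<open>D n \<omega> \<le> K\<close> r_nonneg])
          ultimately show "f (xhat n \<omega>) - (INF x\<in>X. f x) \<le> (2 * K + c) * r n"
            using \<delta>_le by (simp add: algebra_simps)
        qed
      qed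
    qed
    have xhat_in: "xhat n \<omega> \<in> X" if "\<omega> \<in> E n" for n \<omega>
      using xhat[of n] sets.sets_into_space[OF E(1)[of n]] that by blast
    have "bigO_outer_prob M (\<lambda>n \<omega>. ereal (f (xhat n \<omega>)) - inf_val X f) r"
    proof (rule bigO_outer_probI[OF tight E(1,2)])
      fix K
      have "\<forall>\<^sub>F n in sequentially. AE \<omega> in M. \<omega> \<in> E n \<longrightarrow> D n \<omega> \<le> K \<longrightarrow>
          \<bar>ereal (f (xhat n \<omega>)) - inf_val X f\<bar> \<le> ereal ((2 * K + c) * r n)"
        using excess[of K]
      proof eventually_elim
        case (elim n)
        then show ?case
        proof eventually_elim
          case (elim \<omega>)
          \<comment> \<open>Since \<open>xhat n \<omega>\<close> lies in \<open>X\<close>, the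
            excess is nonnegative and the one-sided bound is also the bound on its absolute
            value.\<close>
          then show ?case
            using INF_le[OF X f xhat_in, of \<omega> n] by (auto simp: inf_f)
        qed
      qed
      then show "\<exists>C. \<forall>\<^sub>F n in sequentially. AE \<omega> in M. \<omega> \<in> E n \<longrightarrow> D n \<omega> \<le> K \<longrightarrow>
          \<bar>ereal (f (xhat n \<omega>)) - inf_val X f\<bar> \<le> ereal (C * r n)"
        by blast
    qed
    moreover have "bigO_outer_prob M (\<lambda>n \<omega>. ereal (infdist (e (xhat n \<omega>)) (e ` near_min X f 0)))
        (\<lambda>n. real n powr (- 1 / (2 * \<kappa>)))"
      if \<kappa>: "\<kappa> \<ge> 1" and growth: "sharp_growth e X f \<kappa>" for \<kappa> and e :: "'a \<Rightarrow> real ^ 'd"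
    proof (rule bigO_outer_probI[OF tight E(1,2)])
      fix K
      obtain \<alpha> where \<alpha>: "\<alpha> > 0" "\<And>x. x \<in> X \<Longrightarrow>
          \<alpha> * infdist (e x) (e ` near_min X f 0) powr \<kappa> \<le> f x - (INF x\<in>X. f x)"
        using growth unfolding sharp_growth_def inf_f by auto
      have r_powr: "r n powr (1 / \<kappa>) = real n powr (- 1 / (2 * \<kappa>))" for n
        by (simp add: r_def powr_powr)
      have "\<forall>\<^sub>F n in sequentially. AE \<omega> in M. \<omega> \<in> E n \<longrightarrow> D n \<omega> \<le> K \<longrightarrow>
          \<bar>ereal (infdist (e (xhat n \<omega>)) (e ` near_min X f 0))\<bar>
            \<le> ereal ((\<bar>2 * K + c\<bar> / \<alpha>) powr (1 / \<kappa>) * real n powr (- 1 / (2 * \<kappa>)))"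
        using excess[of K]
      proof eventually_elim
        case (elim n)
        then show ?case
        proof eventually_elim
          case (elim \<omega>)
          show ?case
          proof (intro impI)
            assume \<omega>: "\<omega> \<in> E n" "D n \<omega> \<le> K"
            \<comment> \<open>Sharp growth bounds \<open>\<alpha>\<close> times the power
              \<open>\<kappa>\<close> of the distance by the excess, hence by
              \<open>(2 * K + c) * r n\<close>; roots of order \<open>\<kappa>\<close> give the
              distance.\<close>
            have "infdist (e (xhat n \<omega>)) (e ` near_min X f 0)
                \<le> (\<bar>2 * K + c\<bar> / \<alpha>) powr (1 / \<kappa>) * r n powr (1 / \<kappa>)"
              using elim \<omega> \<kappa> \<alpha>(2)[OF xhat_in[OF \<omega>(1)]]
              by (intro le_of_mult_powr_le \<alpha>(1) r_nonneg infdist_nonneg) auto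
            then show "\<bar>ereal (infdist (e (xhat n \<omega>)) (e ` near_min X f 0))\<bar>
                \<le> ereal ((\<bar>2 * K + c\<bar> / \<alpha>) powr (1 / \<kappa>) * real n powr (- 1 / (2 * \<kappa>)))"
              by (simp add: r_powr infdist_nonneg)
          qed
        qed
      qed
      then show "\<exists>C. \<forall>\<^sub>F n in sequentially. AE \<omega> in M. \<omega> \<in> E n \<longrightarrow> D n \<omega> \<le> K \<longrightarrow>
          \<bar>ereal (infdist (e (xhat n \<omega>)) (e ` near_min X f 0))\<bar> \<le> ereal (C * real n powr (- 1 / (2 * \<kappa>)))"
        by blast
    qed
    ultimately show ?thesis
      by blast
  qed
  show ?thesis
    using lim weak value_rate minimizer_rates unfolding r_def by blast
qed

end
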